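(* Let $\beta=2$. For every integer $p\ge 1$, $$S_2(p)=\frac{2^{p-1}-1}{2^p-1},$$ and $S_2(p)$ is increasing in $p$ and converges to $\frac12$ as $p\to\infty$.
   Context: For $\beta\in(1,2]$ let $T_\beta:[0,1)\to[0,1)$, $T_\beta(x)=\beta x \pmod 1$. For $t\in[0,1)$ the survivor set is $K_\beta(t)=\{x\in[0,1): T_\beta^n(x)\ge t \text{ for all } n\ge 0\}$. A point $x$ has smallest period $p$ if $T_\beta^p(x)=x$ and $T_\beta^j(x)\ne x$ for all $1\le j<p$. For a positive integer $p$, $$S_\beta(p)=\sup\{t\in[0,1): K_\beta(t)\text{ contains a point of smallest period } p\}.$$ *)

theory Defs imports Complex_Main begin

definition beta_map :: "real \<Rightarrow> real \<Rightarrow> real" where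
  "beta_map \<beta> x = frac (\<beta> * x)"

definition survivor_set :: "real \<Rightarrow> real \<Rightarrow> real set" where
  "survivor_set \<beta> t = {x \<in> {0..<1}. \<forall>n. (beta_map \<beta> ^^ n) x \<ge> t}"

definition has_smallest_period :: "('a \<Rightarrow> 'a) \<Rightarrow> 'a \<Rightarrow> nat \<Rightarrow> bool" where
  "has_smallest_period f x p \<longleftrightarrow>
     p \<ge> 1 \<and> (f ^^ p) x = x \<and> (\<forall>j. 1 \<le> j \<and> j < p \<longrightarrow> (f ^^ j) x \<noteq> x)"

definition period_threshold :: "real \<Rightarrow> nat \<Rightarrow> real" where
  "period_threshold \<beta> p =
     Sup {t \<in> {0..<1}. \<exists>x \<in> survivor_set \<beta> t. has_smallest_period (beta_map \<beta>) x p}"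

end

theory Submission imports Defs begin

text \<open>
  Every point with \<open>T\<^sup>p y = y\<close> for the doubling map \<open>T\<close> satisfies \<open>(2\<^sup>p - 1) y = k\<close> for an
  integer \<open>k\<close>. On \<open>(1/2, 1)\<close> the map is \<open>y \<mapsto> 2 y - 1\<close>, with repelling fixed point \<open>1\<close>: it
  doubles the distance to \<open>1\<close>, so a periodic orbit cannot stay above \<open>1/2\<close>. A point of the
  orbit at or below \<open>1/2\<close> has \<open>2 k \<le> 2\<^sup>p - 1\<close>, and since the right-hand side is odd,
  \<open>k \<le> 2\<^sup>p\<^sup>-\<^sup>1 - 1\<close>. Hence the minimum of a periodic orbit is at most
  \<open>(2\<^sup>p\<^sup>-\<^sup>1 - 1) / (2\<^sup>p - 1)\<close> (lemma \<open>survivor_threshold_le\<close>).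

  The bound is attained by the point with the purely periodic binary expansion \<open>0 1 \<dots> 1\<close>
  (period \<open>p\<close>). After one step its orbit lies at distance \<open>1 / (2\<^sup>p - 1)\<close> from \<open>1\<close>; this distance
  then doubles until the orbit returns to its minimum (lemma \<open>doubling_orbit_extremal\<close>). So the
  supremum is a maximum, and monotonicity and the limit can be read off from the form
  \<open>1/2 - 1 / (2 (2\<^sup>p - 1))\<close> of its value.
\<close>

definition extremal_point :: "nat \<Rightarrow> real" where
  "extremal_point p = (2 ^ (p - 1) - 1) / (2 ^ p - 1)"

lemma extremal_point_eq:
  assumes "p \<ge> 1"
  shows "extremal_point p = 1 / 2 - 1 / (2 * (2 ^ p - 1))"
proof -
  obtain q where p: "p = Suc q" using assms by (cases p) auto
  have "(2::real) ^ q \<ge> 1" by simp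
  then have "2 * 2 ^ q - 1 \<noteq> (0::real)" by linarith
  then show ?thesis by (simp add: extremal_point_def p field_simps)
qed

lemma funpow_doubling:
  assumes "x \<in> {0..<1}"
  shows "(beta_map 2 ^^ n) x = frac (2 ^ n * x)"
proof (induction n)
  case 0
  then show ?case using assms by (simp add: frac_eq)
next
  case (Suc n)
  have "frac (2 * frac y) = frac (2 * y)" for y :: real
  proof -
    have "2 * y = 2 * frac y + of_int (2 * \<lfloor>y\<rfloor>)" unfolding frac_def by simp
    then show ?thesis by (metis frac_add_of_int_right)
  qed
  then show ?case using Suc by (simp add: beta_map_def mult.assoc)
qed

lemma beta_map_doubling_upper_half:
  assumes "1 / 2 \<le> y" "y < 1"
  shows "1 - beta_map 2 y = 2 * (1 - y)"
proof -
  have "frac (2 * y) = 2 * y - 1"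
    using assms by (subst frac_unique_iff) auto
  then show ?thesis by (simp add: beta_map_def)
qed

text \<open>A periodic orbit in \<open>(1/2, 1)\<close> would double its positive distance to \<open>1\<close> in every step
  and yet return to the initial distance.\<close>

lemma periodic_orbit_meets_lower_half:
  assumes x: "x \<in> {0..<1}" and p: "p \<ge> 1" and per: "(beta_map 2 ^^ p) x = x"
  shows "\<exists>n. (beta_map 2 ^^ n) x \<le> 1 / 2"
proof (rule ccontr)
  assume "\<not> ?thesis"
  then have gt: "(beta_map 2 ^^ n) x > 1 / 2" for n by (simp add: not_le)
  have "1 - (beta_map 2 ^^ n) x = 2 ^ n * (1 - x)" for n
  proof (induction n)
    case (Suc n)
    have "(beta_map 2 ^^ n) x < 1" by (simp add: funpow_doubling[OF x] frac_lt_1)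
    then show ?case
      using beta_map_doubling_upper_half[of "(beta_map 2 ^^ n) x"] gt[of n] Suc by simp
  qed simp
  from this[of p] per have "2 ^ p * (1 - x) = 1 * (1 - x)" by simp
  then have "(2::real) ^ p = 1" using x by simp
  moreover have "(2::real) ^ p > 1" using p by simp
  ultimately show False by simp
qed

lemma periodic_point_le_extremal:
  assumes y: "y \<in> {0..<1}" "y \<le> 1 / 2" and p: "p \<ge> 1" and per: "(beta_map 2 ^^ p) y = y"
  shows "y \<le> extremal_point p"
proof -
  obtain q where q: "p = Suc q" using p by (cases p) auto
  define k where "k = \<lfloor>2 ^ p * y\<rfloor>"
  have pos: "(2::real) ^ p - 1 > 0" using p by simp
  have k: "(2 ^ p - 1) * y = of_int k"
    using per by (simp add: funpow_doubling[OF y(1)] frac_def k_def algebra_simps)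
  have "(2 ^ p - 1) * y \<le> (2 ^ p - 1) * (1 / 2)"
    using y(2) pos by (intro mult_left_mono) auto
  then have "real_of_int (2 * k) \<le> of_int (2 ^ p - 1)" using k by simp
  then have "2 * k \<le> 2 ^ p - 1" by (simp only: of_int_le_iff)
  then have "k \<le> 2 ^ q - 1" by (simp add: q)
  then have "real_of_int k \<le> of_int (2 ^ q - 1)" by (simp only: of_int_le_iff)
  then show ?thesis
    using k pos by (simp add: extremal_point_def q field_simps)
qed

lemma survivor_threshold_le:
  assumes x: "x \<in> survivor_set 2 t" and per: "has_smallest_period (beta_map 2) x p"
  shows "t \<le> extremal_point p"
proof -
  have p: "p \<ge> 1" and per': "(beta_map 2 ^^ p) x = x"
    using per by (auto simp: has_smallest_period_def)
  have x01: "x \<in> {0..<1}" and ge: "(beta_map 2 ^^ n) x \<ge> t" for n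
    using x by (auto simp: survivor_set_def)
  obtain n where n: "(beta_map 2 ^^ n) x \<le> 1 / 2"
    using periodic_orbit_meets_lower_half[OF x01 p per'] by blast
  define y where "y = (beta_map 2 ^^ n) x"
  have "(beta_map 2 ^^ p) y = (beta_map 2 ^^ n) ((beta_map 2 ^^ p) x)"
    by (simp add: y_def funpow_add[symmetric, THEN fun_cong, simplified] add.commute)
  then have "(beta_map 2 ^^ p) y = y" by (simp add: per' y_def)
  moreover have "y \<in> {0..<1}" by (simp add: y_def funpow_doubling[OF x01] frac_lt_1)
  ultimately have "y \<le> extremal_point p"
    using periodic_point_le_extremal n p by (simp add: y_def)
  then show ?thesis using ge[of n] by (simp add: y_def)
qed

lemma extremal_point_range:
  assumes "p \<ge> 1"
  shows "extremal_point p \<in> {0..<1}"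
proof -
  have "(2::real) ^ p \<ge> 2 ^ 1" using assms by (intro power_increasing) auto
  then show ?thesis by (simp add: extremal_point_eq[OF assms] field_simps)
qed

text \<open>The starting point lies below \<open>1/2\<close>, where the distance to \<open>1\<close> is not simply doubled;
  hence the exponent counts the doublings from the first image. The range of \<open>j\<close> includes \<open>p\<close>,
  where the formula gives back the starting point.\<close>

lemma doubling_orbit_extremal:
  assumes j: "1 \<le> j" "j \<le> p"
  shows "(beta_map 2 ^^ j) (extremal_point p) = 1 - 2 ^ (j - 1) / (2 ^ p - 1)"
proof -
  obtain i where i: "j = Suc i" using j by (cases j) auto
  have p: "p \<ge> 1" using j by simp
  have "(2::real) ^ Suc i \<le> 2 ^ p" using j i by (intro power_increasing) auto
  moreover have "(2::real) ^ i \<ge> 1" by simp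
  ultimately have le: "(2::real) ^ i \<le> 2 ^ p - 1" and pos: "(2::real) ^ p - 1 > 0"
    unfolding power_Suc by linarith+
  have "2 ^ j * extremal_point p = 2 ^ i - 2 ^ i / (2 ^ p - 1)"
    using pos by (simp add: extremal_point_eq[OF p] i field_simps)
  then have "2 ^ j * extremal_point p - (1 - 2 ^ i / (2 ^ p - 1)) = of_int (2 ^ i - 1)"
    by simp
  then have "2 ^ j * extremal_point p - (1 - 2 ^ i / (2 ^ p - 1)) \<in> \<int>"
    by (simp only: Ints_of_int)
  then have "frac (2 ^ j * extremal_point p) = 1 - 2 ^ i / (2 ^ p - 1)"
    using le pos by (subst frac_unique_iff) (simp_all add: field_simps)
  then show ?thesis
    unfolding funpow_doubling[OF extremal_point_range[OF p]] by (simp add: i)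
qed

lemma extremal_point_eq_gap:
  assumes "p \<ge> 1"
  shows "extremal_point p = 1 - 2 ^ (p - 1) / (2 ^ p - 1)"
proof -
  have "(2::real) ^ p > 1" using assms by simp
  then show ?thesis using assms by (cases p) (simp_all add: extremal_point_def field_simps)
qed

lemma funpow_extremal:
  assumes "p \<ge> 1"
  shows "(beta_map 2 ^^ p) (extremal_point p) = extremal_point p"
  by (rule trans[OF doubling_orbit_extremal[OF assms order.refl]
        extremal_point_eq_gap[OF assms, symmetric]])

lemma doubling_orbit_extremal_gt:
  assumes j: "1 \<le> j" "j < p"
  shows "extremal_point p < (beta_map 2 ^^ j) (extremal_point p)"
proof -
  have p: "p \<ge> 1" using j by simp
  have "(2::real) ^ (j - 1) < 2 ^ (p - 1)" using j by (intro power_strict_increasing) auto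
  moreover have "(2::real) ^ p - 1 > 0" using p by simp
  ultimately have "(2::real) ^ (j - 1) / (2 ^ p - 1) < 2 ^ (p - 1) / (2 ^ p - 1)"
    by (rule divide_strict_right_mono)
  then show ?thesis
    using doubling_orbit_extremal[of j p] extremal_point_eq_gap[OF p] j by simp
qed

lemma extremal_point_smallest_period:
  assumes "p \<ge> 1"
  shows "has_smallest_period (beta_map 2) (extremal_point p) p"
  unfolding has_smallest_period_def
proof (intro conjI allI impI)
  show "p \<ge> 1" by fact
  show "(beta_map 2 ^^ p) (extremal_point p) = extremal_point p"
    by (rule funpow_extremal[OF assms])
  fix j assume "1 \<le> j \<and> j < p"
  then have "extremal_point p < (beta_map 2 ^^ j) (extremal_point p)"
    by (intro doubling_orbit_extremal_gt) auto
  then show "(beta_map 2 ^^ j) (extremal_point p) \<noteq> extremal_point p"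
    by (rule less_imp_neq[symmetric])
qed

lemma extremal_point_survives:
  assumes p: "p \<ge> 1"
  shows "extremal_point p \<in> survivor_set 2 (extremal_point p)"
proof -
  have "(beta_map 2 ^^ n) (extremal_point p) \<ge> extremal_point p" for n
  proof -
    have "(beta_map 2 ^^ (n mod p)) (extremal_point p) \<ge> extremal_point p"
      using doubling_orbit_extremal_gt[of "n mod p" p] p
      by (cases "n mod p = 0") (auto intro: less_imp_le)
    then show ?thesis using funpow_mod_eq[OF funpow_extremal[OF p]] by simp
  qed
  then show ?thesis using extremal_point_range[OF p] by (simp add: survivor_set_def)
qed

lemma period_threshold_doubling:
  assumes p: "p \<ge> 1"
  shows "period_threshold 2 p = extremal_point p"
  unfolding period_threshold_def
proof (rule cSup_eq_maximum)
  show "extremal_point p \<in>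
    {t \<in> {0..<1}. \<exists>x \<in> survivor_set 2 t. has_smallest_period (beta_map 2) x p}"
    using extremal_point_range[OF p] extremal_point_survives[OF p]
      extremal_point_smallest_period[OF p] by blast
next
  fix t assume "t \<in> {t \<in> {0..<1}. \<exists>x \<in> survivor_set 2 t. has_smallest_period (beta_map 2) x p}"
  then show "t \<le> extremal_point p" using survivor_threshold_le by blast
qed

lemma extremal_point_strict_mono: "strict_mono_on {1..} extremal_point"
proof (rule strict_mono_onI)
  fix p q :: nat
  assume "p \<in> {1..}" "q \<in> {1..}" and less: "p < q"
  then have p: "p \<ge> 1" "q \<ge> 1" by auto
  have "(2::real) ^ p < 2 ^ q" using less by (intro power_strict_increasing) auto
  moreover have "(2::real) ^ p > 1" using p by simp
  ultimately have "1 / (2 * ((2::real) ^ q - 1)) < 1 / (2 * (2 ^ p - 1))"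
    by (intro divide_strict_left_mono) auto
  then show "extremal_point p < extremal_point q"
    by (simp add: extremal_point_eq[OF p(1)] extremal_point_eq[OF p(2)])
qed

lemma extremal_point_tendsto: "extremal_point \<longlonglongrightarrow> 1 / 2"
proof -
  have "filterlim (\<lambda>p. -1 + (2::real) ^ p) at_top sequentially"
  proof (rule filterlim_at_top_mono)
    show "filterlim (\<lambda>p. -1 + real p) at_top sequentially"
      by (rule filterlim_tendsto_add_at_top[OF tendsto_const filterlim_real_sequentially])
    show "\<forall>\<^sub>F p in sequentially. -1 + real p \<le> -1 + 2 ^ p"
      by (intro always_eventually allI add_left_mono less_imp_le of_nat_less_two_power)
  qed
  then have "(\<lambda>p. inverse (-1 + (2::real) ^ p)) \<longlonglongrightarrow> 0"
    by (rule tendsto_inverse_0_at_top)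
  then have "(\<lambda>p. 1 / 2 - inverse (-1 + (2::real) ^ p) / 2) \<longlonglongrightarrow> 1 / 2 - 0 / 2"
    by (intro tendsto_intros) auto
  then have "(\<lambda>p. 1 / 2 - inverse (-1 + (2::real) ^ p) / 2) \<longlonglongrightarrow> 1 / 2"
    by simp
  moreover have "\<forall>\<^sub>F p in sequentially.
      1 / 2 - inverse (-1 + (2::real) ^ p) / 2 = extremal_point p"
    using eventually_ge_at_top[of "1::nat"]
    by eventually_elim (simp add: extremal_point_eq inverse_eq_divide algebra_simps)
  ultimately show ?thesis by (rule Lim_transform_eventually)
qed

theorem mainTheorem2:
  shows "(\<forall>p::nat. p \<ge> 1 \<longrightarrow> period_threshold 2 p = (2 ^ (p - 1) - 1) / (2 ^ p - 1)) \<and>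
         strict_mono_on {1..} (period_threshold 2) \<and>
         period_threshold 2 \<longlonglongrightarrow> 1 / 2"
proof (intro conjI allI impI)
  fix p :: nat assume "p \<ge> 1"
  then show "period_threshold 2 p = (2 ^ (p - 1) - 1) / (2 ^ p - 1)"
    by (simp add: period_threshold_doubling extremal_point_def)
next
  show "strict_mono_on {1..} (period_threshold 2)"
    using extremal_point_strict_mono
    by (simp add: strict_mono_on_def period_threshold_doubling)
next
  have "\<forall>\<^sub>F p in sequentially. extremal_point p = period_threshold 2 p"
    using eventually_ge_at_top[of "1::nat"]
    by eventually_elim (simp add: period_threshold_doubling)
  then show "period_threshold 2 \<longlonglongrightarrow> 1 / 2"
    using extremal_point_tendsto by (rule Lim_transform_eventually[rotated])
qed

end
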